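(* For all graphs $G$ and $H$, $$\iota(G\boxtimes H)\le \iota(G)\,\iota(H)+r_{\iota}(G)\,\iota(H)+r_{\iota}(H)\,\iota(G),$$ and the bound is sharp, i.e. there exist graphs $G$ and $H$ for which equality holds.
   Context: All graphs are finite, simple and undirected. The strong product $G\boxtimes H$ has vertex set $V(G)\times V(H)$, and distinct vertices $(g,h)$, $(g',h')$ are adjacent if and only if ($g=g'$ or $gg'\in E(G)$) and ($h=h'$ or $hh'\in E(H)$). A set $S\subseteq V(G)$ is an isolating set of $G$ if $V(G)-N_G[S]$ induces a graph with no edges, where $N_G[S]$ is the closed neighborhood of $S$; $\iota(G)$ is the minimum cardinality of an isolating set of $G$, and an $\iota(G)$-set is an isolating set of cardinality $\iota(G)$. Define $r_{\iota}(G)=\min\{|V(G)-N_G[S]| : S \text{ is an } \iota(G)\text{-set}\}$. *)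

theory Defs
  imports "Graph_Theory.Digraph_Component" "Graph_Theory.Pair_Digraph"
begin

text \<open>
  A finite simple undirected graph is a \<^locale>\<open>pair_graph\<close>: a finite vertex set with a
  symmetric, irreflexive set of arcs, so that an edge \<open>uv\<close> is represented by the two arcs
  \<open>(u,v)\<close> and \<open>(v,u)\<close>.
\<close>

definition strong_product ::
  "'a pair_pre_digraph \<Rightarrow> 'b pair_pre_digraph \<Rightarrow> ('a \<times> 'b) pair_pre_digraph"
  (infixr \<open>\<boxtimes>\<close> 80) where
  "G \<boxtimes> H = \<lparr> pverts = pverts G \<times> pverts H,
     parcs = {((g, h), (g', h')) | g h g' h'.
       (g, h) \<in> pverts G \<times> pverts H \<and> (g', h') \<in> pverts G \<times> pverts H \<and>
       (g, h) \<noteq> (g', h') \<and>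
       (g = g' \<or> (g, g') \<in> parcs G) \<and> (h = h' \<or> (h, h') \<in> parcs H)} \<rparr>"

definition closed_nbhd :: "'a pair_pre_digraph \<Rightarrow> 'a set \<Rightarrow> 'a set" where
  "closed_nbhd G S = S \<union> {v. \<exists>s\<in>S. (s, v) \<in> parcs G}"

definition isolating_set :: "'a pair_pre_digraph \<Rightarrow> 'a set \<Rightarrow> bool" where
  "isolating_set G S \<longleftrightarrow>
     S \<subseteq> pverts G \<and> arcs (with_proj G \<restriction> (pverts G - closed_nbhd G S)) = {}"

text \<open>
  For a finite graph both minima below range over nonempty finite sets, since \<open>pverts G\<close> is
  itself an isolating set.
\<close>

definition isolation_number :: "'a pair_pre_digraph \<Rightarrow> nat" (\<open>\<iota>\<close>) where
  "\<iota> G = Min (card ` {S. isolating_set G S})"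

definition iota_set :: "'a pair_pre_digraph \<Rightarrow> 'a set \<Rightarrow> bool" where
  "iota_set G S \<longleftrightarrow> isolating_set G S \<and> card S = \<iota> G"

definition residual_number :: "'a pair_pre_digraph \<Rightarrow> nat" (\<open>r\<^sub>\<iota>\<close>) where
  "r\<^sub>\<iota> G = Min {card (pverts G - closed_nbhd G S) | S. iota_set G S}"

lemma pair_graph_strong_product:
  assumes "pair_graph G" and "pair_graph H"
  shows "pair_graph (G \<boxtimes> H)"
proof -
  interpret G: pair_graph G by fact
  interpret H: pair_graph H by fact
  have fin: "finite (pverts G \<times> pverts H)"
    using G.pair_finite_verts H.pair_finite_verts by simp
  have sub: "parcs (G \<boxtimes> H) \<subseteq> (pverts G \<times> pverts H) \<times> (pverts G \<times> pverts H)"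
    by (auto simp: strong_product_def)
  show ?thesis
  proof
    show "fst e \<in> pverts (G \<boxtimes> H)" "snd e \<in> pverts (G \<boxtimes> H)" "fst e \<noteq> snd e"
      if "e \<in> parcs (G \<boxtimes> H)" for e
      using that by (auto simp: strong_product_def)
    show "finite (pverts (G \<boxtimes> H))" using fin by (simp add: strong_product_def)
    show "finite (parcs (G \<boxtimes> H))" using sub fin by (meson finite_SigmaI finite_subset)
    show "symmetric (with_proj (G \<boxtimes> H))"
      unfolding symmetric_def with_proj_simps
      by (rule symI) (auto simp: strong_product_def intro: G.arcs_symmetric H.arcs_symmetric)
  qed
qed

lemma isolation_minima_well_defined:
  assumes "pair_graph G"
  shows "finite {S. isolating_set G S}" and "isolating_set G (pverts G)"
    and "\<exists>S. iota_set G S"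
proof -
  interpret pair_graph G by fact
  have "{S. isolating_set G S} \<subseteq> Pow (pverts G)" by (auto simp: isolating_set_def)
  then show fin: "finite {S. isolating_set G S}"
    using pair_finite_verts by (meson finite_Pow_iff finite_subset)
  show iso: "isolating_set G (pverts G)"
    by (auto simp: isolating_set_def closed_nbhd_def)
  have "\<iota> G \<in> card ` {S. isolating_set G S}"
    unfolding isolation_number_def using fin iso by (intro Min_in) auto
  then show "\<exists>S. iota_set G S" by (auto simp: iota_set_def)
qed

end

theory Submission
  imports Defs
begin

text \<open>
  Let \<open>S\<close> and \<open>T\<close> be minimum isolating sets of \<open>G\<close> and \<open>H\<close> that leave as few vertices uncovered
  as possible, and let \<open>Q\<close> and \<open>R\<close> be the (independent) sets of vertices that they leave.  In a
  strong product the closed neighbourhood of \<open>A \<times> B\<close> is \<open>N[A] \<times> N[B]\<close>.  Hence \<open>S \<times> T\<close> covers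
  \<open>N[S] \<times> N[T]\<close>, while \<open>Q \<times> T\<close> covers \<open>Q \<times> N[T]\<close> and \<open>S \<times> R\<close> covers \<open>N[S] \<times> R\<close>.  Only vertices
  of \<open>Q \<times> R\<close> stay uncovered, and a product of independent sets is independent in the strong
  product.  The three pieces have the three sizes on the right-hand side
  (\<open>isolating_set_strong_product\<close>, \<open>isolation_number_strong_product_le\<close>).

  Equality is attained by \<open>G = H = K\<^sub>2 \<union> K\<^sub>1\<close>, an edge with an isolated vertex, where each of the three
  terms of the bound is 1: the product is \<open>K\<^sub>4 \<union> K\<^sub>2 \<union> K\<^sub>2 \<union> K\<^sub>1\<close>, and an isolating set needs a vertex in
  each of the three components with an edge (\<open>isolation_number_edge_plus_vertex_square\<close>).
\<close>

lemma isolating_set_iff: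
  "isolating_set G S \<longleftrightarrow> S \<subseteq> pverts G \<and>
     (\<forall>u v. (u, v) \<in> parcs G \<longrightarrow> u \<in> pverts G - closed_nbhd G S \<longrightarrow>
       v \<notin> pverts G - closed_nbhd G S)"
  by (auto simp: isolating_set_def induce_subgraph_arcs)

lemma isolation_number_le:
  assumes "pair_graph G" "isolating_set G S"
  shows "\<iota> G \<le> card S"
  unfolding isolation_number_def
  using isolation_minima_well_defined(1)[OF assms(1)] assms(2) by (intro Min_le) auto

lemma finite_residuals:
  assumes "pair_graph G"
  shows "finite {card (pverts G - closed_nbhd G S) | S. iota_set G S}"
proof -
  have "{S. iota_set G S} \<subseteq> {S. isolating_set G S}" by (auto simp: iota_set_def)
  then have "finite {S. iota_set G S}"
    using isolation_minima_well_defined(1)[OF assms] by (rule finite_subset)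
  then show ?thesis by simp
qed

lemma residual_number_le:
  assumes "pair_graph G" "iota_set G S"
  shows "r\<^sub>\<iota> G \<le> card (pverts G - closed_nbhd G S)"
  unfolding residual_number_def using finite_residuals[OF assms(1)] assms(2)
  by (intro Min_le) auto

lemma residual_number_attained:
  assumes "pair_graph G"
  obtains S where "isolating_set G S" "card S = \<iota> G"
    "card (pverts G - closed_nbhd G S) = r\<^sub>\<iota> G"
proof -
  have "r\<^sub>\<iota> G \<in> {card (pverts G - closed_nbhd G S) | S. iota_set G S}"
    unfolding residual_number_def
    using finite_residuals[OF assms] isolation_minima_well_defined(3)[OF assms]
    by (intro Min_in) auto
  then show thesis using that by (auto simp: iota_set_def)
qed

section \<open>The upper bound\<close>

lemma closed_nbhd_strong_product:
  assumes "pair_graph G" "pair_graph H" "A \<subseteq> pverts G" "B \<subseteq> pverts H"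
  shows "closed_nbhd (G \<boxtimes> H) (A \<times> B) = closed_nbhd G A \<times> closed_nbhd H B"
proof -
  interpret G: pair_graph G by fact
  interpret H: pair_graph H by fact
  show ?thesis
    using assms(3,4) G.in_arcsD1 G.in_arcsD2 H.in_arcsD1 H.in_arcsD2
    by (fastforce simp: closed_nbhd_def strong_product_def)
qed

lemma closed_nbhd_mono: "S \<subseteq> T \<Longrightarrow> closed_nbhd G S \<subseteq> closed_nbhd G T"
  by (auto simp: closed_nbhd_def)

lemma isolating_set_strong_product:
  fixes G :: "'a pair_pre_digraph" and H :: "'b pair_pre_digraph"
  assumes "pair_graph G" "pair_graph H" "isolating_set G S" "isolating_set H T"
  defines "Q \<equiv> pverts G - closed_nbhd G S" and "R \<equiv> pverts H - closed_nbhd H T"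
  shows "isolating_set (G \<boxtimes> H) (S \<times> T \<union> Q \<times> T \<union> S \<times> R)" (is "isolating_set _ ?D")
proof -
  have ST: "S \<subseteq> pverts G" "T \<subseteq> pverts H"
    using assms(3,4) by (auto simp: isolating_set_iff)
  have QR: "Q \<subseteq> pverts G" "R \<subseteq> pverts H" by (auto simp: Q_def R_def)
  have "closed_nbhd (G \<boxtimes> H) (A \<times> B) \<subseteq> closed_nbhd (G \<boxtimes> H) ?D"
    if "A \<times> B \<subseteq> ?D" for A B using that by (rule closed_nbhd_mono)
  from this[of S T] this[of Q T] this[of S R]
  have "closed_nbhd G S \<times> closed_nbhd H T \<union> closed_nbhd G Q \<times> closed_nbhd H T
      \<union> closed_nbhd G S \<times> closed_nbhd H R \<subseteq> closed_nbhd (G \<boxtimes> H) ?D"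
    using ST QR by (auto simp: closed_nbhd_strong_product[OF assms(1,2)])
  moreover have "Q \<subseteq> closed_nbhd G Q" "R \<subseteq> closed_nbhd H R" by (auto simp: closed_nbhd_def)
  ultimately have uncovered: "pverts (G \<boxtimes> H) - closed_nbhd (G \<boxtimes> H) ?D \<subseteq> Q \<times> R"
    by (fastforce simp: Q_def R_def strong_product_def)
  have indep: "(u, v) \<notin> parcs (G \<boxtimes> H)" if "u \<in> Q \<times> R" "v \<in> Q \<times> R" for u v
    using assms(3,4) that
    by (fastforce simp: isolating_set_iff Q_def R_def strong_product_def)
  have "?D \<subseteq> pverts (G \<boxtimes> H)" using ST QR by (auto simp: strong_product_def)
  then show ?thesis using uncovered indep unfolding isolating_set_iff by blast
qed

lemma isolation_number_strong_product_le:
  assumes "pair_graph G" "pair_graph H"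
  shows "\<iota> (G \<boxtimes> H) \<le> \<iota> G * \<iota> H + r\<^sub>\<iota> G * \<iota> H + r\<^sub>\<iota> H * \<iota> G"
proof -
  obtain S where S: "isolating_set G S" "card S = \<iota> G"
      "card (pverts G - closed_nbhd G S) = r\<^sub>\<iota> G"
    using assms(1) by (rule residual_number_attained)
  obtain T where T: "isolating_set H T" "card T = \<iota> H"
      "card (pverts H - closed_nbhd H T) = r\<^sub>\<iota> H"
    using assms(2) by (rule residual_number_attained)
  let ?Q = "pverts G - closed_nbhd G S" and ?R = "pverts H - closed_nbhd H T"
  have "\<iota> (G \<boxtimes> H) \<le> card (S \<times> T \<union> ?Q \<times> T \<union> S \<times> ?R)"
    using pair_graph_strong_product[OF assms] isolating_set_strong_product[OF assms S(1) T(1)]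
    by (rule isolation_number_le)
  also have "\<dots> \<le> card (S \<times> T) + card (?Q \<times> T) + card (S \<times> ?R)"
    by (meson add_le_mono1 card_Un_le le_trans)
  also have "\<dots> = \<iota> G * \<iota> H + r\<^sub>\<iota> G * \<iota> H + r\<^sub>\<iota> H * \<iota> G"
    using S T by (simp add: card_cartesian_product)
  finally show ?thesis .
qed

section \<open>Sharpness\<close>

definition edge_plus_vertex :: "nat pair_pre_digraph" where
  "edge_plus_vertex = \<lparr> pverts = {0, 1, 2}, parcs = {(0, 1), (1, 0)} \<rparr>"

lemma pair_graph_edge_plus_vertex: "pair_graph edge_plus_vertex"
  by unfold_locales (auto simp: edge_plus_vertex_def symmetric_def intro!: symI)

text \<open>
  The vertex 0 dominates the edge and leaves only the isolated vertex 2.  Upper bounds on the two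
  parameters suffice for sharpness: the product bound increases with both of them, so it is at most
  3, and 3 is a lower bound for the isolation number of the product.
\<close>

lemma edge_plus_vertex_parameters_le:
  "\<iota> edge_plus_vertex \<le> 1" "r\<^sub>\<iota> edge_plus_vertex \<le> 1"
proof -
  have nbhd: "closed_nbhd edge_plus_vertex {0} = {0, 1}"
    by (auto simp: closed_nbhd_def edge_plus_vertex_def)
  then have iso: "isolating_set edge_plus_vertex {0}"
    unfolding isolating_set_iff nbhd by (auto simp: edge_plus_vertex_def)
  show le: "\<iota> edge_plus_vertex \<le> 1"
    using isolation_number_le[OF pair_graph_edge_plus_vertex iso] by simp
  have "\<not> isolating_set edge_plus_vertex {}"
    by (auto simp: isolating_set_iff closed_nbhd_def edge_plus_vertex_def)
  moreover obtain S where "isolating_set edge_plus_vertex S" "card S = \<iota> edge_plus_vertex"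
    using pair_graph_edge_plus_vertex by (rule residual_number_attained)
  moreover from this have "finite S"
    by (auto simp: isolating_set_iff edge_plus_vertex_def intro: finite_subset)
  ultimately have "\<iota> edge_plus_vertex \<noteq> 0" by (metis card_0_eq)
  with le iso have "iota_set edge_plus_vertex {0}" by (simp add: iota_set_def)
  from residual_number_le[OF pair_graph_edge_plus_vertex this]
  show "r\<^sub>\<iota> edge_plus_vertex \<le> 1" unfolding nbhd by (simp add: edge_plus_vertex_def)
qed

lemma isolating_set_meets_edge_nbhd:
  assumes "isolating_set G S" "(u, v) \<in> parcs G" "u \<in> pverts G" "v \<in> pverts G"
  shows "\<exists>s\<in>S. s = u \<or> s = v \<or> (s, u) \<in> parcs G \<or> (s, v) \<in> parcs G"
  using assms by (fastforce simp: isolating_set_iff closed_nbhd_def)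

text \<open>
  The sets \<open>{0,1} \<times> {0,1}\<close>, \<open>{0,1} \<times> {2}\<close> and \<open>{2} \<times> {0,1}\<close> are the components of the product that
  have an edge; one edge is chosen in each.
\<close>

lemma isolation_number_edge_plus_vertex_square:
  "3 \<le> \<iota> (edge_plus_vertex \<boxtimes> edge_plus_vertex)" (is "_ \<le> \<iota> ?P")
proof -
  have "pair_graph ?P"
    using pair_graph_edge_plus_vertex pair_graph_edge_plus_vertex
    by (rule pair_graph_strong_product)
  then obtain S where S: "isolating_set ?P S" "card S = \<iota> ?P"
    by (rule residual_number_attained)
  have "S \<subseteq> {0, 1, 2} \<times> {0, 1, 2}"
    using S(1) by (auto simp: isolating_set_iff strong_product_def edge_plus_vertex_def)
  then have "finite S" by (rule finite_subset) simp
  have "\<exists>s\<in>S. s \<in> {0, 1} \<times> {0, 1}"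
    using isolating_set_meets_edge_nbhd[OF S(1), of "(0, 0)" "(1, 0)"]
    by (fastforce simp: strong_product_def edge_plus_vertex_def)
  then obtain a where a: "a \<in> S" "a \<in> {0, 1} \<times> {0, 1}" by blast
  have "\<exists>s\<in>S. s \<in> {0, 1} \<times> {2}"
    using isolating_set_meets_edge_nbhd[OF S(1), of "(0, 2)" "(1, 2)"]
    by (fastforce simp: strong_product_def edge_plus_vertex_def)
  then obtain b where b: "b \<in> S" "b \<in> {0, 1} \<times> {2}" by blast
  have "\<exists>s\<in>S. s \<in> {2} \<times> {0, 1}"
    using isolating_set_meets_edge_nbhd[OF S(1), of "(2, 0)" "(2, 1)"]
    by (fastforce simp: strong_product_def edge_plus_vertex_def)
  then obtain c where c: "c \<in> S" "c \<in> {2} \<times> {0, 1}" by blast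
  have "card {a, b, c} = 3" using a(2) b(2) c(2) by auto
  moreover have "card {a, b, c} \<le> card S"
    using a(1) b(1) c(1) \<open>finite S\<close> by (intro card_mono) auto
  ultimately show ?thesis using S(2) by simp
qed

lemma strong_product_bound_sharp:
  "\<iota> (edge_plus_vertex \<boxtimes> edge_plus_vertex)
     = \<iota> edge_plus_vertex * \<iota> edge_plus_vertex + r\<^sub>\<iota> edge_plus_vertex * \<iota> edge_plus_vertex
       + r\<^sub>\<iota> edge_plus_vertex * \<iota> edge_plus_vertex" (is "_ = ?bound")
proof (rule antisym)
  show "\<iota> (edge_plus_vertex \<boxtimes> edge_plus_vertex) \<le> ?bound"
    using pair_graph_edge_plus_vertex pair_graph_edge_plus_vertex
    by (rule isolation_number_strong_product_le)
  have "?bound \<le> 1 * 1 + 1 * 1 + 1 * 1"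
    using edge_plus_vertex_parameters_le by (intro add_mono mult_le_mono)
  then show "?bound \<le> \<iota> (edge_plus_vertex \<boxtimes> edge_plus_vertex)"
    using isolation_number_edge_plus_vertex_square by linarith
qed

theorem proposition4p2:
  shows "(\<forall>(G :: 'a pair_pre_digraph) (H :: 'b pair_pre_digraph).
            pair_graph G \<longrightarrow> pair_graph H \<longrightarrow>
            \<iota> (G \<boxtimes> H) \<le> \<iota> G * \<iota> H + r\<^sub>\<iota> G * \<iota> H + r\<^sub>\<iota> H * \<iota> G)
       \<and> (\<exists>(G :: nat pair_pre_digraph) (H :: nat pair_pre_digraph).
            pair_graph G \<and> pair_graph H \<and> pverts G \<noteq> {} \<and> pverts H \<noteq> {} \<and>
            \<iota> (G \<boxtimes> H) = \<iota> G * \<iota> H + r\<^sub>\<iota> G * \<iota> H + r\<^sub>\<iota> H * \<iota> G)"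
proof (intro conjI allI impI exI)
  show "pverts edge_plus_vertex \<noteq> {}" "pverts edge_plus_vertex \<noteq> {}"
    by (simp_all add: edge_plus_vertex_def)
qed (rule isolation_number_strong_product_le pair_graph_edge_plus_vertex
    strong_product_bound_sharp; assumption?)+

end
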